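(* Let $I=[-1,1]$, let $\varepsilon>0$ and $F\in C^1(I)$ with $F(-1)=0$, $F\ge 0$ on $I$, and $0<\sigma(F)<\infty$, where $\sigma(F)=\int_{-1}^{1}\sqrt{2F(u)}\,\mathrm du$. For any $\sigma_{\rm obs}>0$, exactly one member of the scale class $\{(s\varepsilon,s^2F):s>0\}$ has tension $\sigma_{\rm obs}$ (i.e. satisfies $\sigma(s^2F)=\sigma_{\rm obs}$), namely the one with $s_*=\sigma_{\rm obs}/\sigma(F)$, that is, $(\widehat\varepsilon,\widehat F)=(s_*\varepsilon,s_*^2F)$. Equivalently, given a nonnegative normalized primitive $\widehat H$ on $I$ with $0<C_{\widehat H}:=\int_I\sqrt{2\widehat H(u)}\,\mathrm du<\infty$, the unique calibrated pair with that primitive and tension $\sigma_{\rm obs}$, i.e. the unique pair $(\widehat\varepsilon,\widehat F)$ with $\widehat\varepsilon>0$, $\widehat F/\widehat\varepsilon^{\,2}=\widehat H$ and $\sigma(\widehat F)=\sigma_{\rm obs}$, is $$\widehat\varepsilon=\frac{\sigma_{\rm obs}}{C_{\widehat H}},\qquad \widehat F(u)=\widehat\varepsilon^{\,2}\,\widehat H(u).$$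
   Context: A pair $(\varepsilon,F)$ with $\varepsilon>0$, $F\in C^1([-1,1])$ is normalized when $F(-1)=0$; its effective force is $G=F'/\varepsilon^2$ and its primitive is $H(u)=\int_{-1}^uG(z)\,\mathrm dz=F(u)/\varepsilon^2$. A normalized primitive is a function $\widehat H\in C^1([-1,1])$ with $\widehat H(-1)=0$. The (surface) tension of a pair $(\varepsilon,F)$ is $\sigma(F)=\int_{-1}^{1}\sqrt{2F(u)}\,\mathrm du$. *)

theory Defs
  imports "HOL-Analysis.Analysis"
begin

abbreviation phase_interval :: "real set"  (\<open>\<I>\<close>) where
  "\<I> \<equiv> {-1..1}"

text \<open>
  Functions on the interval are represented by extensional functions, so that HOL equality is
  equality on the interval. The derivative is taken within the interval, i.e. one-sided at the
  end points (unlike in \<^const>\<open>C1_differentiable_on\<close>).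
\<close>

definition C1_fun :: "(real \<Rightarrow> real) set" where
  "C1_fun = {f \<in> extensional \<I>. \<exists>f'. continuous_on \<I> f' \<and>
               (\<forall>u\<in>\<I>. (f has_real_derivative f' u) (at u within \<I>))}"

definition normalized_pair :: "real \<times> (real \<Rightarrow> real) \<Rightarrow> bool" where
  "normalized_pair = (\<lambda>(\<epsilon>, F). \<epsilon> > 0 \<and> F \<in> C1_fun \<and> F (-1) = 0)"

definition normalized_primitive :: "(real \<Rightarrow> real) \<Rightarrow> bool" where
  "normalized_primitive H \<longleftrightarrow> H \<in> C1_fun \<and> H (-1) = 0"

definition effective_force :: "real \<times> (real \<Rightarrow> real) \<Rightarrow> real \<Rightarrow> real" where
  "effective_force = (\<lambda>(\<epsilon>, F) u. vector_derivative F (at u within \<I>) / \<epsilon>\<^sup>2)"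

definition primitive :: "real \<times> (real \<Rightarrow> real) \<Rightarrow> real \<Rightarrow> real" where
  "primitive p = (\<lambda>u\<in>\<I>. integral {-1..u} (effective_force p))"

text \<open>
  Only meaningful for functions that are nonnegative on the interval: \<^const>\<open>sqrt\<close> is odd in HOL.
\<close>

definition tension :: "(real \<Rightarrow> real) \<Rightarrow> real" where
  "tension F = integral \<I> (\<lambda>u. sqrt (2 * F u))"

definition scale_pair :: "real \<Rightarrow> real \<times> (real \<Rightarrow> real) \<Rightarrow> real \<times> (real \<Rightarrow> real)" where
  "scale_pair s = (\<lambda>(\<epsilon>, F). (s * \<epsilon>, \<lambda>u\<in>\<I>. s\<^sup>2 * F u))"

definition scale_class :: "real \<times> (real \<Rightarrow> real) \<Rightarrow> (real \<times> (real \<Rightarrow> real)) set" where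
  "scale_class p = {scale_pair s p | s. s > 0}"

definition calibrated_pair :: "(real \<Rightarrow> real) \<Rightarrow> real \<Rightarrow> real \<times> (real \<Rightarrow> real) \<Rightarrow> bool" where
  "calibrated_pair H \<sigma> p \<longleftrightarrow> normalized_pair p \<and> primitive p = H \<and> tension (snd p) = \<sigma>"

end

theory Submission
  imports Defs
begin

text \<open>
  Tension is homogeneous of degree one along a scale class:
  \<open>sqrt (2 * (s\<^sup>2 * F u)) = s * sqrt (2 * F u)\<close> for \<open>s \<ge> 0\<close>, so scaling by \<open>s\<close> multiplies the
  tension by \<open>s\<close> (\<open>tension_scale\<close>). When the tension of \<open>F\<close> is positive, prescribing the tension
  of the scaled pair is therefore a linear equation for \<open>s\<close> with the single root
  \<open>\<sigma>obs / tension F\<close>.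

  The second half is the same equation with the primitive in the role of \<open>F\<close>. By the fundamental
  theorem of calculus the primitive of a normalized pair is \<open>F / \<epsilon>\<^sup>2\<close> (\<open>primitive_normalized_pair\<close>).
  The pairs whose primitive is \<open>H\<close> are thus exactly the pairs \<open>(\<epsilon>, \<epsilon>\<^sup>2 * H)\<close>
  (\<open>calibrated_pair_iff\<close>): they are the scale class of \<open>(1, H)\<close>, with \<open>\<epsilon>\<close> as the scale parameter.
\<close>

lemma tension_scale:
  assumes "s \<ge> 0"
  shows "tension (\<lambda>u\<in>\<I>. s\<^sup>2 * F u) = s * tension F"
proof -
  have "tension (\<lambda>u\<in>\<I>. s\<^sup>2 * F u) = integral \<I> (\<lambda>u. s * sqrt (2 * F u))"
    unfolding tension_def using assms
    by (intro integral_cong) (simp add: real_sqrt_mult)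
  then show ?thesis
    by (simp add: tension_def)
qed

lemma tension_scale_eq_iff:
  assumes "s > 0" "tension F > 0"
  shows "tension (\<lambda>u\<in>\<I>. s\<^sup>2 * F u) = \<sigma> \<longleftrightarrow> s = \<sigma> / tension F"
  using assms by (auto simp: tension_scale[of s] eq_divide_eq)

lemma C1_fun_scale:
  assumes "f \<in> C1_fun"
  shows "(\<lambda>u\<in>\<I>. c * f u) \<in> C1_fun"
proof -
  obtain f' where f': "continuous_on \<I> f'"
      "\<And>u. u \<in> \<I> \<Longrightarrow> (f has_real_derivative f' u) (at u within \<I>)"
    using assms by (auto simp: C1_fun_def)
  have "((\<lambda>u\<in>\<I>. c * f u) has_real_derivative c * f' u) (at u within \<I>)" if "u \<in> \<I>" for u
    by (rule has_field_derivative_transform_within[OF DERIV_cmult[OF f'(2)[OF that]] zero_less_one that])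
      simp
  moreover have "continuous_on \<I> (\<lambda>u. c * f' u)"
    using f'(1) by (intro continuous_intros)
  ultimately show ?thesis
    by (auto simp: C1_fun_def)
qed

text \<open>
  This is the fundamental theorem of calculus; the normalization \<open>F (-1) = 0\<close> removes the boundary
  term at the lower end point.
\<close>

lemma primitive_normalized_pair:
  assumes "normalized_pair (\<epsilon>, F)"
  shows "primitive (\<epsilon>, F) = (\<lambda>u\<in>\<I>. F u / \<epsilon>\<^sup>2)"
proof -
  have F0: "F (-1) = 0"
    using assms by (simp add: normalized_pair_def)
  obtain f' where f': "\<And>u. u \<in> \<I> \<Longrightarrow> (F has_real_derivative f' u) (at u within \<I>)"
    using assms unfolding normalized_pair_def C1_fun_def by blast
  have force: "effective_force (\<epsilon>, F) u = f' u / \<epsilon>\<^sup>2" if "u \<in> \<I>" for u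
  proof -
    have "(F has_vector_derivative f' u) (at u within \<I>)"
      using f'[OF that] by (simp add: has_real_derivative_iff_has_vector_derivative)
    then have "vector_derivative F (at u within \<I>) = f' u"
      using that by (intro vector_derivative_within_closed_interval) auto
    then show ?thesis
      by (simp add: effective_force_def)
  qed
  have "integral {-1..u} (effective_force (\<epsilon>, F)) = F u / \<epsilon>\<^sup>2" if u: "u \<in> \<I>" for u
  proof (rule integral_unique)
    have "(effective_force (\<epsilon>, F) has_integral F u / \<epsilon>\<^sup>2 - F (-1) / \<epsilon>\<^sup>2) {-1..u}"
    proof (rule fundamental_theorem_of_calculus)
      fix x assume x: "x \<in> {-1..u}"
      then have "x \<in> \<I>"
        using u by auto
      then have "((\<lambda>u. F u / \<epsilon>\<^sup>2) has_real_derivative effective_force (\<epsilon>, F) x) (at x within \<I>)"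
        unfolding force[OF \<open>x \<in> \<I>\<close>] by (intro DERIV_cdivide f')
      then have "((\<lambda>u. F u / \<epsilon>\<^sup>2) has_real_derivative effective_force (\<epsilon>, F) x) (at x within {-1..u})"
        using u by (elim has_field_derivative_subset) auto
      then show "((\<lambda>u. F u / \<epsilon>\<^sup>2) has_vector_derivative effective_force (\<epsilon>, F) x) (at x within {-1..u})"
        by (simp add: has_real_derivative_iff_has_vector_derivative)
    qed (use u in auto)
    then show "(effective_force (\<epsilon>, F) has_integral F u / \<epsilon>\<^sup>2) {-1..u}"
      by (simp add: F0)
  qed
  then show ?thesis
    by (auto simp: primitive_def restrict_def)
qed

lemma divide_eq_iff_eq_restrict:
  fixes F H :: "real \<Rightarrow> real"
  assumes "F \<in> extensional A" "c \<noteq> 0"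
  shows "(\<forall>u\<in>A. F u / c = H u) \<longleftrightarrow> F = (\<lambda>u\<in>A. c * H u)"
  using assms by (auto simp: fun_eq_iff restrict_def extensional_def field_simps)

text \<open>
  Regularity and normalization of \<open>F\<close> are inherited from \<open>H\<close>, since \<open>F\<close> is a constant multiple of it.
  Hence the differential notion of primitive and the pointwise equation \<open>F / \<epsilon>\<^sup>2 = H\<close> select the same
  pairs.
\<close>

lemma calibrated_pair_iff:
  assumes "normalized_primitive H"
  shows "calibrated_pair H \<sigma> (\<epsilon>, F) \<longleftrightarrow>
    F \<in> extensional \<I> \<and> \<epsilon> > 0 \<and> (\<forall>u\<in>\<I>. F u / \<epsilon>\<^sup>2 = H u) \<and> tension F = \<sigma>"
proof
  assume cal: "calibrated_pair H \<sigma> (\<epsilon>, F)"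
  then have np: "normalized_pair (\<epsilon>, F)" and "primitive (\<epsilon>, F) = H" and "tension F = \<sigma>"
    by (auto simp: calibrated_pair_def)
  moreover have "F u / \<epsilon>\<^sup>2 = H u" if "u \<in> \<I>" for u
    using primitive_normalized_pair[OF np] \<open>primitive (\<epsilon>, F) = H\<close> that by auto
  ultimately show "F \<in> extensional \<I> \<and> \<epsilon> > 0 \<and> (\<forall>u\<in>\<I>. F u / \<epsilon>\<^sup>2 = H u) \<and> tension F = \<sigma>"
    by (auto simp: normalized_pair_def C1_fun_def)
next
  assume rhs: "F \<in> extensional \<I> \<and> \<epsilon> > 0 \<and> (\<forall>u\<in>\<I>. F u / \<epsilon>\<^sup>2 = H u) \<and> tension F = \<sigma>"
  then have F: "F = (\<lambda>u\<in>\<I>. \<epsilon>\<^sup>2 * H u)"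
    using divide_eq_iff_eq_restrict[of F \<I> "\<epsilon>\<^sup>2" H] by simp
  have H: "H \<in> C1_fun" "H (-1) = 0" "H \<in> extensional \<I>"
    using assms by (auto simp: normalized_primitive_def C1_fun_def)
  then have np: "normalized_pair (\<epsilon>, F)"
    using rhs C1_fun_scale[of H "\<epsilon>\<^sup>2"] by (simp add: normalized_pair_def F)
  have "primitive (\<epsilon>, F) = restrict H \<I>"
    unfolding primitive_normalized_pair[OF np] using rhs by (intro restrict_ext) auto
  then have "primitive (\<epsilon>, F) = H"
    using H(3) by (simp add: extensional_restrict)
  then show "calibrated_pair H \<sigma> (\<epsilon>, F)"
    using np rhs by (simp add: calibrated_pair_def)
qed

lemma given_quotient_and_tension_iff:
  assumes "F \<in> extensional \<I>" "tension H > 0" "\<sigma> > 0"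
  shows "\<epsilon> > 0 \<and> (\<forall>u\<in>\<I>. F u / \<epsilon>\<^sup>2 = H u) \<and> tension F = \<sigma> \<longleftrightarrow>
    \<epsilon> = \<sigma> / tension H \<and> F = (\<lambda>u\<in>\<I>. (\<sigma> / tension H)\<^sup>2 * H u)"
proof -
  have "\<epsilon> > 0 \<and> (\<forall>u\<in>\<I>. F u / \<epsilon>\<^sup>2 = H u) \<and> tension F = \<sigma> \<longleftrightarrow>
      \<epsilon> > 0 \<and> F = (\<lambda>u\<in>\<I>. \<epsilon>\<^sup>2 * H u) \<and> tension F = \<sigma>"
    using divide_eq_iff_eq_restrict[OF assms(1), of "\<epsilon>\<^sup>2" H] by auto
  also have "\<dots> \<longleftrightarrow> \<epsilon> > 0 \<and> F = (\<lambda>u\<in>\<I>. \<epsilon>\<^sup>2 * H u) \<and> \<epsilon> = \<sigma> / tension H"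
    using tension_scale_eq_iff[OF _ assms(2)] by blast
  also have "\<dots> \<longleftrightarrow> \<epsilon> = \<sigma> / tension H \<and> F = (\<lambda>u\<in>\<I>. (\<sigma> / tension H)\<^sup>2 * H u)"
    using assms(2,3) by auto
  finally show ?thesis .
qed

theorem proposition2:
  fixes \<sigma>obs :: real
  assumes "\<sigma>obs > 0"
  shows
    "(\<forall>\<epsilon> F. normalized_pair (\<epsilon>, F) \<and> (\<forall>u\<in>\<I>. F u \<ge> 0) \<and>
        (\<lambda>u. sqrt (2 * F u)) integrable_on \<I> \<and> tension F > 0 \<longrightarrow>
        (\<exists>!p. p \<in> scale_class (\<epsilon>, F) \<and> tension (snd p) = \<sigma>obs) \<and>
        (\<forall>s>0. tension (\<lambda>u\<in>\<I>. s\<^sup>2 * F u) = \<sigma>obs \<longleftrightarrow> s = \<sigma>obs / tension F) \<and>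
        (let s = \<sigma>obs / tension F; p = (s * \<epsilon>, \<lambda>u\<in>\<I>. s\<^sup>2 * F u)
         in s > 0 \<and> p \<in> scale_class (\<epsilon>, F) \<and> tension (snd p) = \<sigma>obs)) \<and>
     (\<forall>H. normalized_primitive H \<and> (\<forall>u\<in>\<I>. H u \<ge> 0) \<and>
        (\<lambda>u. sqrt (2 * H u)) integrable_on \<I> \<and> integral \<I> (\<lambda>u. sqrt (2 * H u)) > 0 \<longrightarrow>
        (let C = integral \<I> (\<lambda>u. sqrt (2 * H u));
             \<epsilon>h = \<sigma>obs / C;
             Fh = (\<lambda>u\<in>\<I>. \<epsilon>h\<^sup>2 * H u)
         in (\<forall>p. calibrated_pair H \<sigma>obs p \<longleftrightarrow> p = (\<epsilon>h, Fh)) \<and>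
            (\<forall>\<epsilon>. \<forall>F \<in> extensional \<I>.
               \<epsilon> > 0 \<and> (\<forall>u\<in>\<I>. F u / \<epsilon>\<^sup>2 = H u) \<and> tension F = \<sigma>obs \<longleftrightarrow>
               \<epsilon> = \<epsilon>h \<and> F = Fh)))"
proof (intro conjI allI impI, goal_cases)
  case (1 \<epsilon> F)
  define s where "s = \<sigma>obs / tension F"
  have T: "tension F > 0"
    using 1 by simp
  then have "s > 0"
    using assms by (simp add: s_def)
  then have "scale_pair s (\<epsilon>, F) \<in> scale_class (\<epsilon>, F)"
    by (auto simp: scale_class_def)
  moreover have "tension (snd (scale_pair s (\<epsilon>, F))) = \<sigma>obs"
    using tension_scale_eq_iff[OF \<open>s > 0\<close> T] by (simp add: scale_pair_def s_def)
  moreover have "p = scale_pair s (\<epsilon>, F)"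
    if "p \<in> scale_class (\<epsilon>, F)" "tension (snd p) = \<sigma>obs" for p
  proof -
    obtain t where t: "t > 0" "p = scale_pair t (\<epsilon>, F)"
      using \<open>p \<in> scale_class (\<epsilon>, F)\<close> by (auto simp: scale_class_def)
    then have "t = s"
      using that(2) tension_scale_eq_iff[OF \<open>t > 0\<close> T] by (simp add: scale_pair_def s_def)
    then show ?thesis
      using t by simp
  qed
  ultimately show ?case
    by blast
next
  case (2 \<epsilon> F s)
  then show ?case
    by (intro tension_scale_eq_iff) auto
next
  case (3 \<epsilon> F)
  define s where "s = \<sigma>obs / tension F"
  have T: "tension F > 0"
    using 3 by simp
  then have "s > 0"
    using assms by (simp add: s_def)
  moreover have "(s * \<epsilon>, \<lambda>u\<in>\<I>. s\<^sup>2 * F u) \<in> scale_class (\<epsilon>, F)"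
    using \<open>s > 0\<close> by (auto simp: scale_class_def scale_pair_def)
  moreover have "tension (\<lambda>u\<in>\<I>. s\<^sup>2 * F u) = \<sigma>obs"
    using tension_scale_eq_iff[OF \<open>s > 0\<close> T] by (simp add: s_def)
  ultimately show ?case
    unfolding Let_def s_def[symmetric] by simp
next
  case (4 H)
  then have T: "tension H > 0" and np: "normalized_primitive H"
    by (auto simp: tension_def)
  have "calibrated_pair H \<sigma>obs (\<epsilon>, F) \<longleftrightarrow>
      \<epsilon> = \<sigma>obs / tension H \<and> F = (\<lambda>u\<in>\<I>. (\<sigma>obs / tension H)\<^sup>2 * H u)" for \<epsilon> F
    using calibrated_pair_iff[OF np] given_quotient_and_tension_iff[OF _ T assms]
    by (metis restrict_extensional)
  then show ?case
    unfolding Let_def tension_def[of H, symmetric]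
    using given_quotient_and_tension_iff[OF _ T assms] by (simp add: split_paired_all)
qed

end
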